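(* Let $(X,\|\cdot\|)$ be a real normed space, let $\Omega_1,\ldots,\Omega_n\subset X$ be nonempty closed convex sets, and let $\|\cdot\|_{\mathbb{R}^n}$ be a norm on $\mathbb{R}^n$, with dual norm $\|\cdot\|_{\mathbb{R}^n}^*$, such that: (A1) $\|(\alpha_1,\ldots,\alpha_n)\|_{\mathbb{R}^n}=\|(\pm\alpha_1,\ldots,\pm\alpha_n)\|_{\mathbb{R}^n}$ for all $(\alpha_1,\ldots,\alpha_n)\in\mathbb{R}^n$ and all choices of signs; (A2) $\|\alpha\|_{\mathbb{R}^n}\le\|\beta\|_{\mathbb{R}^n}$ for all $\alpha=(\alpha_1,\ldots,\alpha_n),\beta=(\beta_1,\ldots,\beta_n)\in\mathbb{R}^n$ with $|\alpha_i|\le|\beta_i|$ $(i=1,\ldots,n)$. Let $\mathrm{Sol}$ be the set of all global minimisers over $X$ of $$f(x):=\|(d(x,\Omega_1),\ldots,d(x,\Omega_n))\|_{\mathbb{R}^n},\quad x\in X,$$ and let $\bar x\in X$ with $\bar x\notin\bigcup_{i=1}^n\Omega_i$. Then the following assertions hold. (i) $\bar x\in\mathrm{Sol}$ if and only if there exist $(\lambda_1,\ldots,\lambda_n)\in\mathbb{R}^n_+$ and $x_i^*\in\partial d(\cdot,\Omega_i)(\bar x)$ $(i=1,\ldots,n)$ such that $$\sum_{i=1}^n\lambda_ix_i^*=0,\quad \|(\lambda_1,\ldots,\lambda_n)\|^*_{\mathbb{R}^n}=1,\quad \sum_{i=1}^n\lambda_id(\bar x,\Omega_i)=\|(d(\bar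 x,\Omega_1),\ldots,d(\bar x,\Omega_n))\|_{\mathbb{R}^n}.\qquad(\ast)$$ (ii) Let $(\lambda_1,\ldots,\lambda_n)\in\mathbb{R}^n_+$ and $x_i^*\in\partial d(\cdot,\Omega_i)(\bar x)$ $(i=1,\ldots,n)$ satisfy $(\ast)$. Then $$\mathrm{Sol}=\Big\{x\in X\;\Big|\; x_i^*\in\partial d(\cdot,\Omega_i)(x)\text{ for all } i \text{ with }\lambda_i>0,\ \sum_{\lambda_i>0}\lambda_id(x,\Omega_i)=\|(d(x,\Omega_1),\ldots,d(x,\Omega_n))\|_{\mathbb{R}^n}\Big\}.$$
   Context: $X^*$ is the topological dual of $X$ with pairing $\langle\cdot,\cdot\rangle$. $d(x,\Omega):=\inf_{u\in\Omega}\|x-u\|$. For a convex function $g:X\to\mathbb{R}$, $\partial g(\bar x):=\{x^*\in X^*\mid\langle x^*,x-\bar x\rangle\le g(x)-g(\bar x)\ \text{for all } x\in X\}$. $\mathbb{R}^n_+$ is the set of vectors in $\mathbb{R}^n$ with nonnegative components. The dual norm on $\mathbb{R}^n$ is $\|\lambda\|^*_{\mathbb{R}^n}:=\sup\{\sum_{i}\lambda_i u_i\mid\|u\|_{\mathbb{R}^n}\le1\}$. *)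

theory Defs
  imports "HOL-Analysis.Analysis"
begin

definition is_norm :: "('v::real_vector \<Rightarrow> real) \<Rightarrow> bool" where
  "is_norm N \<longleftrightarrow>
     (\<forall>u. 0 \<le> N u) \<and>
     (\<forall>u. N u = 0 \<longleftrightarrow> u = 0) \<and>
     (\<forall>c u. N (c *\<^sub>R u) = \<bar>c\<bar> * N u) \<and>
     (\<forall>u v. N (u + v) \<le> N u + N v)"

(* For a norm N the set is nonempty and bounded above (finite dimension), so the
   conditionally complete supremum on the reals is the true supremum. *)
definition dual_norm :: "(real ^ 'n \<Rightarrow> real) \<Rightarrow> real ^ 'n \<Rightarrow> real" where
  "dual_norm N l = Sup {(\<Sum>i\<in>UNIV. l $ i * u $ i) | u. N u \<le> 1}"

(* The topological dual of X is the type of bounded linear functionals on X. *)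
definition subdifferential ::
  "('a::real_normed_vector \<Rightarrow> real) \<Rightarrow> 'a \<Rightarrow> ('a \<Rightarrow>\<^sub>L real) set" where
  "subdifferential g xbar =
     {xs. \<forall>x. blinfun_apply xs (x - xbar) \<le> g x - g xbar}"

(* infdist x A is the infimum of the distances from x to A, except that it is 0 for
   empty A; the sets are assumed nonempty wherever it is used. *)
definition dist_vec ::
  "('n \<Rightarrow> 'a::real_normed_vector set) \<Rightarrow> 'a \<Rightarrow> real ^ 'n" where
  "dist_vec \<Omega> x = (\<chi> i. infdist x (\<Omega> i))"

definition global_minimisers :: "('a \<Rightarrow> real) \<Rightarrow> 'a set" where
  "global_minimisers f = {x. \<forall>y. f x \<le> f y}"

definition Sol ::
  "(real ^ 'n \<Rightarrow> real) \<Rightarrow> ('n \<Rightarrow> 'a::real_normed_vector set) \<Rightarrow> 'a set" where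
  "Sol N \<Omega> = global_minimisers (\<lambda>x. N (dist_vec \<Omega> x))"

definition multiplier_condition ::
  "(real ^ 'n \<Rightarrow> real) \<Rightarrow> ('n \<Rightarrow> 'a::real_normed_vector set) \<Rightarrow> 'a \<Rightarrow>
    real ^ 'n \<Rightarrow> ('n \<Rightarrow> ('a \<Rightarrow>\<^sub>L real)) \<Rightarrow> bool" where
  "multiplier_condition N \<Omega> xbar l xs \<longleftrightarrow>
     (\<Sum>i\<in>UNIV. (l $ i) *\<^sub>R xs i) = 0 \<and>
     dual_norm N l = 1 \<and>
     (\<Sum>i\<in>UNIV. l $ i * infdist xbar (\<Omega> i)) = N (dist_vec \<Omega> xbar)"

end

theory Submission
  imports Defs
begin

text \<open>Given a multiplier, the dual norm inequality and the subgradient inequalities bound the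
  objective from below by its value at \<open>xbar\<close>; equality throughout this chain characterises the
  minimisers. Conversely, at a minimiser a hyperplane in the finite-dimensional space separates the
  open \<open>N\<close>-ball from the upward closure of the distance vectors. Its normal yields weights for which
  \<open>xbar\<close> minimises the weighted sum of the distances, and a sum rule, proved by Hahn-Banach, splits
  the zero functional into subgradients of the individual distances.\<close>

section \<open>Hahn-Banach extension below a convex function\<close>

text \<open>Only an inequality is required for positive scalars, because infima inherit it directly.
  Equality follows by applying it to the inverse scalar as well.\<close>

definition sublinear :: "('a::real_vector \<Rightarrow> real) \<Rightarrow> bool" where
  "sublinear p \<longleftrightarrow>
     (\<forall>x y. p (x + y) \<le> p x + p y) \<and> (\<forall>c x. 0 < c \<longrightarrow> p (c *\<^sub>R x) \<le> c * p x)"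

lemma sublinear_add: "sublinear p \<Longrightarrow> p (x + y) \<le> p x + p y"
  by (simp add: sublinear_def)

lemma sublinear_scale:
  assumes "sublinear p" "0 \<le> c"
  shows "p (c *\<^sub>R x) = c * p x"
proof (cases "c = 0")
  case True
  \<comment> \<open>The scalars 2 and 1/2 at the origin give \<open>0 \<le> p 0\<close> and
    \<open>p 0 \<le> 0\<close>.\<close>
  have "p (2 *\<^sub>R 0) \<le> 2 * p 0" "p ((1/2) *\<^sub>R 0) \<le> (1/2) * p 0"
    using assms(1) unfolding sublinear_def by (meson zero_less_numeral half_gt_zero_iff zero_less_one)+
  then have "p 0 = 0" by simp
  then show ?thesis using True by simp
next
  case False
  then have "0 < c" using assms(2) by simp
  then have "p (c *\<^sub>R x) \<le> c * p x" "p (inverse c *\<^sub>R (c *\<^sub>R x)) \<le> inverse c * p (c *\<^sub>R x)"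
    using assms(1) unfolding sublinear_def by (meson positive_imp_inverse_positive)+
  then show ?thesis using \<open>0 < c\<close> by (simp add: field_simps)
qed

lemma sublinear_zero: "sublinear p \<Longrightarrow> p 0 = 0"
  using sublinear_scale[of p 0 0] by simp

text \<open>Each \<open>A x\<close> is a set of upper estimates for the value at \<open>x\<close>.
  Estimates can be added and scaled up to a decrease, which passes to the infima;
  \<open>zero\<close> keeps these infima finite.\<close>

lemma sublinear_Inf:
  fixes A :: "'a::real_vector \<Rightarrow> real set"
  assumes ne: "\<And>x. A x \<noteq> {}"
    and zero: "\<And>c. c \<in> A 0 \<Longrightarrow> 0 \<le> c"
    and add: "\<And>x y a b. a \<in> A x \<Longrightarrow> b \<in> A y \<Longrightarrow> \<exists>c\<in>A (x + y). c \<le> a + b"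
    and scale: "\<And>x t a. a \<in> A x \<Longrightarrow> 0 < t \<Longrightarrow> \<exists>c\<in>A (t *\<^sub>R x). c \<le> t * a"
  shows "bdd_below (A x)" and "sublinear (\<lambda>x. Inf (A x))"
proof -
  have bdd: "bdd_below (A x)" for x
  proof -
    \<comment> \<open>An estimate \<open>b\<close> at \<open>- x\<close> bounds \<open>A x\<close>
      below by \<open>- b\<close>, since \<open>a + b\<close> dominates an element of
      \<open>A 0\<close>.\<close>
    obtain b where b: "b \<in> A (- x)" using ne by blast
    have "- b \<le> a" if "a \<in> A x" for a
      using add[OF that b] zero by force
    then show ?thesis by (rule bdd_belowI)
  qed
  then show "bdd_below (A x)" .
  have "Inf (A (x + y)) \<le> Inf (A x) + Inf (A y)" for x y
  proof -
    have *: "Inf (A (x + y)) \<le> a + b" if "a \<in> A x" "b \<in> A y" for a b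
      using add[OF that] cInf_lower[OF _ bdd] by (meson order_trans)
    \<comment> \<open>The infimum is taken first over \<open>a\<close> with \<open>b\<close> fixed,
      then over \<open>b\<close>.\<close>
    have "Inf (A (x + y)) - b \<le> Inf (A x)" if "b \<in> A y" for b
      using *[OF _ that] by (intro cInf_greatest[OF ne]) (simp add: diff_le_eq)
    then have "Inf (A (x + y)) - Inf (A x) \<le> Inf (A y)"
      by (intro cInf_greatest[OF ne]) (simp add: algebra_simps)
    then show ?thesis by simp
  qed
  moreover have "Inf (A (t *\<^sub>R x)) \<le> t * Inf (A x)" if "0 < t" for t x
  proof -
    have "Inf (A (t *\<^sub>R x)) / t \<le> a" if a: "a \<in> A x" for a
    proof -
      obtain c where "c \<in> A (t *\<^sub>R x)" "c \<le> t * a" using scale[OF a \<open>0 < t\<close>] by blast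
      then have "Inf (A (t *\<^sub>R x)) \<le> t * a" using cInf_lower[OF _ bdd] by (meson order_trans)
      then show ?thesis using \<open>0 < t\<close> by (simp add: field_simps)
    qed
    then have "Inf (A (t *\<^sub>R x)) / t \<le> Inf (A x)" by (intro cInf_greatest[OF ne])
    then show ?thesis using that by (simp add: field_simps)
  qed
  ultimately show "sublinear (\<lambda>x. Inf (A x))" by (simp add: sublinear_def)
qed

text \<open>For fixed \<open>x\<close>, the infimum over \<open>t \<ge> 0\<close> of
  \<open>q (y + t *\<^sub>R x) - t * q x\<close> is sublinear in \<open>y\<close> and, by
  \<open>t = 0\<close>, lies below \<open>q\<close>; minimality makes it equal to \<open>q\<close>.
  The choice \<open>t = 1\<close> then gives superadditivity, hence additivity.\<close>

lemma minimal_sublinear_linear: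
  fixes q :: "'a::real_vector \<Rightarrow> real"
  assumes q: "sublinear q"
    and min: "\<And>r. sublinear r \<Longrightarrow> (\<And>x. r x \<le> q x) \<Longrightarrow> r = q"
  shows "linear q"
proof -
  have add: "q (y + x) = q y + q x" for x y
  proof -
    let ?A = "\<lambda>y. {q (y + t *\<^sub>R x) - t * q x | t. 0 \<le> t}"
    have A0: "0 \<le> c" if "c \<in> ?A 0" for c
      using that sublinear_scale[OF q] by auto
    have Aadd: "\<exists>c\<in>?A (u + v). c \<le> a + b" if a: "a \<in> ?A u" and b: "b \<in> ?A v" for u v a b
    proof -
      obtain t where t: "0 \<le> t" "a = q (u + t *\<^sub>R x) - t * q x" using a by auto
      obtain s where s: "0 \<le> s" "b = q (v + s *\<^sub>R x) - s * q x" using b by auto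
      have "q ((u + t *\<^sub>R x) + (v + s *\<^sub>R x)) \<le> q (u + t *\<^sub>R x) + q (v + s *\<^sub>R x)"
        by (rule sublinear_add[OF q])
      moreover have "(u + t *\<^sub>R x) + (v + s *\<^sub>R x) = u + v + (t + s) *\<^sub>R x"
        by (simp add: algebra_simps)
      ultimately have "q (u + v + (t + s) *\<^sub>R x) - (t + s) * q x \<le> a + b"
        using t s by (simp add: algebra_simps)
      then show ?thesis using t s by (intro bexI[rotated]) (auto intro!: exI[of _ "t + s"])
    qed
    have Ascale: "\<exists>c\<in>?A (s *\<^sub>R u). c \<le> s * a" if a: "a \<in> ?A u" and s: "0 < s" for u s a
    proof -
      obtain t where t: "0 \<le> t" "a = q (u + t *\<^sub>R x) - t * q x" using a by auto
      have "q (s *\<^sub>R u + (s * t) *\<^sub>R x) - (s * t) * q x = s * a"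
        unfolding t(2) using sublinear_scale[OF q, of s "u + t *\<^sub>R x"] s
        by (simp add: algebra_simps)
      then show ?thesis using t s by (intro bexI[rotated, where x = "s * a"]) (auto intro!: exI[of _ "s * t"])
    qed
    have ne: "?A u \<noteq> {}" for u by auto
    note I = sublinear_Inf[of ?A, OF ne A0 Aadd Ascale]
    have le: "Inf (?A u) \<le> q u" for u
      by (rule cInf_lower[OF _ I(1)]) (auto intro!: exI[of _ 0])
    have eq: "(\<lambda>u. Inf (?A u)) = q" by (rule min[OF I(2) le])
    have "Inf (?A y) \<le> q (y + x) - q x"
      by (rule cInf_lower[OF _ I(1)]) (auto intro!: exI[of _ 1])
    then have "q y \<le> q (y + x) - q x" using fun_cong[OF eq, of y] by simp
    then show ?thesis using sublinear_add[OF q, of y x] by simp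
  qed
  have neg: "q (- x) = - q x" for x
    using add[of "- x" x] sublinear_zero[OF q] by simp
  have "q (c *\<^sub>R x) = c * q x" for c x
  proof (cases "0 \<le> c")
    case True
    then show ?thesis by (rule sublinear_scale[OF q])
  next
    case False
    then have "q ((- c) *\<^sub>R x) = (- c) * q x" by (intro sublinear_scale[OF q]) simp
    then show ?thesis using neg[of "c *\<^sub>R x"] by simp
  qed
  then show ?thesis using add by (intro linearI) auto
qed

text \<open>Zorn's lemma applies because the pointwise infimum of a nonempty chain of sublinear
  minorants is again sublinear.\<close>

lemma ex_minimal_sublinear:
  fixes p :: "'a::real_vector \<Rightarrow> real"
  assumes p: "sublinear p"
  obtains q where "sublinear q" "\<And>x. q x \<le> p x"
    and "\<And>r. sublinear r \<Longrightarrow> (\<And>x. r x \<le> q x) \<Longrightarrow> r = q"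
proof -
  let ?S = "{q. sublinear q \<and> (\<forall>x. q x \<le> p x)}"
  \<comment> \<open>The order is reversed: \<open>?P f g\<close> puts \<open>g\<close> below
    \<open>f\<close>, so upper bounds of chains are pointwise lower bounds and a maximal element is
    a minimal functional.\<close>
  let ?P = "\<lambda>f g :: 'a \<Rightarrow> real. \<forall>x. g x \<le> f x"
  have "\<exists>m\<in>?S. \<forall>a\<in>?S. ?P m a \<longrightarrow> a = m"
  proof (rule predicate_Zorn)
    show "partial_order_on ?S (relation_of ?P ?S)"
      by (rule partial_order_on_relation_ofI)
        (simp, meson order_trans, blast intro: ext order.antisym)
  next
    fix C assume C: "C \<in> Chains (relation_of ?P ?S)"
    then have CS: "C \<subseteq> ?S" by (rule Chains_relation_of)
    have chain: "(\<forall>x. f x \<le> g x) \<or> (\<forall>x. g x \<le> f x)" if "f \<in> C" "g \<in> C" for f g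
      using C that by (auto simp: Chains_def relation_of_def)
    show "\<exists>u\<in>?S. \<forall>a\<in>C. ?P a u"
    proof (cases "C = {}")
      case True
      then show ?thesis using p by auto
    next
      case False
      let ?A = "\<lambda>x. (\<lambda>f. f x) ` C"
      have A0: "0 \<le> c" if "c \<in> ?A 0" for c
        using that CS sublinear_zero by fastforce
      have Aadd: "\<exists>c\<in>?A (x + y). c \<le> a + b" if a: "a \<in> ?A x" and b: "b \<in> ?A y" for x y a b
      proof -
        obtain f where f: "f \<in> C" "a = f x" using a by auto
        obtain g where g: "g \<in> C" "b = g y" using b by auto
        \<comment> \<open>The smaller of \<open>f\<close> and \<open>g\<close> serves both estimates
          at once.\<close>
        obtain h where h: "h \<in> C" "h x \<le> f x" "h y \<le> g y"
          using chain[OF f(1) g(1)] f(1) g(1) by blast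
        have "h (x + y) \<le> h x + h y" using h(1) CS by (auto intro: sublinear_add)
        then show ?thesis using h f g by (intro bexI[of _ "h (x + y)"]) auto
      qed
      have Ascale: "\<exists>c\<in>?A (t *\<^sub>R x). c \<le> t * a" if "a \<in> ?A x" "0 < t" for x t a
        using that CS by (fastforce simp: sublinear_def)
      have ne: "?A x \<noteq> {}" for x using False by auto
      note I = sublinear_Inf[of ?A, OF ne A0 Aadd Ascale]
      have le: "Inf (?A x) \<le> f x" if "f \<in> C" for f x
        using that by (intro cInf_lower[OF _ I(1)]) auto
      obtain f where f: "f \<in> C" using False by auto
      then have "f x \<le> p x" for x using CS by auto
      then have "Inf (?A x) \<le> p x" for x using le[OF f, of x] order_trans by blast
      then show ?thesis using I(2) le by (intro bexI[of _ "\<lambda>x. Inf (?A x)"]) auto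
    qed
  qed
  then obtain q where "q \<in> ?S" and "\<forall>a\<in>?S. ?P q a \<longrightarrow> a = q" by blast
  then show ?thesis by (intro that[of q]) (auto intro: order_trans)
qed

text \<open>The functional is a minimal sublinear minorant of the infimum of the difference quotients
  \<^term>\<open>H (w + t *\<^sub>R u) / t\<close> over \<open>w \<in> D\<close> and \<open>t > 0\<close>, which is at most 0 on \<open>D\<close>.\<close>

lemma convex_on_linear_minorant:
  fixes H :: "'a::real_vector \<Rightarrow> real"
  assumes H: "convex_on UNIV H" and H0: "H 0 = 0"
    and D: "subspace D" and nonneg: "\<And>w. w \<in> D \<Longrightarrow> 0 \<le> H w"
  obtains \<phi> where "linear \<phi>" "\<And>u. \<phi> u \<le> H u" "\<And>w. w \<in> D \<Longrightarrow> \<phi> w = 0"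
proof -
  let ?A = "\<lambda>u. {H (w + t *\<^sub>R u) / t | w t. w \<in> D \<and> 0 < t}"
  have mem: "H (w + t *\<^sub>R u) / t \<in> ?A u" if "w \<in> D" "0 < t" for w t u
    using that by blast
  have A0: "0 \<le> c" if "c \<in> ?A 0" for c
    using that nonneg by auto
  have Aadd: "\<exists>c\<in>?A (u + v). c \<le> a + b" if a: "a \<in> ?A u" and b: "b \<in> ?A v" for u v a b
  proof -
    obtain w t where t: "w \<in> D" "0 < t" "a = H (w + t *\<^sub>R u) / t" using a by blast
    obtain z s where s: "z \<in> D" "0 < s" "b = H (z + s *\<^sub>R v) / s" using b by blast
    \<comment> \<open>The weights are chosen so that \<open>\<alpha> * t = \<beta> * s\<close>: in
      the convex combination of the two points, \<open>u\<close> and \<open>v\<close> then carry the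
      same coefficient.\<close>
    define \<alpha> where "\<alpha> = s / (t + s)"
    define \<beta> where "\<beta> = t / (t + s)"
    have pos: "0 < t + s" "0 < \<alpha>" "0 < \<beta>" "\<alpha> + \<beta> = 1"
      using t s by (auto simp: \<alpha>_def \<beta>_def add_divide_distrib[symmetric] add.commute)
    have bs: "\<beta> * s = \<alpha> * t" by (simp add: \<alpha>_def \<beta>_def)
    let ?r = "\<alpha> * t"
    have r: "0 < ?r" using pos t by simp
    have D': "\<alpha> *\<^sub>R w + \<beta> *\<^sub>R z \<in> D"
      using D t s by (simp add: subspace_add subspace_scale)
    have "(\<alpha> *\<^sub>R w + \<beta> *\<^sub>R z) + ?r *\<^sub>R (u + v) = \<alpha> *\<^sub>R (w + t *\<^sub>R u) + \<beta> *\<^sub>R (z + s *\<^sub>R v)"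
      using bs by (simp add: algebra_simps)
    then have "H ((\<alpha> *\<^sub>R w + \<beta> *\<^sub>R z) + ?r *\<^sub>R (u + v)) \<le> \<alpha> * H (w + t *\<^sub>R u) + \<beta> * H (z + s *\<^sub>R v)"
      using H pos unfolding convex_on_def by simp
    also have "\<dots> = ?r * (a + b)"
    proof -
      have "?r * (a + b) = \<alpha> * t * a + \<beta> * s * b" using bs by (simp add: algebra_simps)
      then show ?thesis using t s by simp
    qed
    finally have "H ((\<alpha> *\<^sub>R w + \<beta> *\<^sub>R z) + ?r *\<^sub>R (u + v)) / ?r \<le> a + b"
      using r by (simp add: pos_divide_le_eq mult.commute)
    then show ?thesis using mem[OF D' r] by blast
  qed
  have Ascale: "\<exists>c\<in>?A (s *\<^sub>R u). c \<le> s * a" if a: "a \<in> ?A u" and s: "0 < s" for u s a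
  proof -
    obtain w t where t: "w \<in> D" "0 < t" "a = H (w + t *\<^sub>R u) / t" using a by blast
    \<comment> \<open>With parameter \<open>t / s\<close> the point stays
      \<open>w + t *\<^sub>R u\<close>, while the quotient is multiplied by
      \<open>s\<close>.\<close>
    have "H (w + (t / s) *\<^sub>R (s *\<^sub>R u)) / (t / s) = s * a"
      using s t by simp
    then have "s * a \<in> ?A (s *\<^sub>R u)"
      using mem[of w "t / s" "s *\<^sub>R u"] t(1,2) s by (metis divide_pos_pos)
    then show ?thesis by blast
  qed
  have D0: "0 \<in> D" using D by (rule subspace_0)
  have ne: "?A u \<noteq> {}" for u using mem[OF D0 zero_less_one] by blast
  note I = sublinear_Inf[of ?A, OF ne A0 Aadd Ascale]
  obtain \<phi> where \<phi>: "sublinear \<phi>" "\<And>u. \<phi> u \<le> Inf (?A u)"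
    and min: "\<And>r. sublinear r \<Longrightarrow> (\<And>x. r x \<le> \<phi> x) \<Longrightarrow> r = \<phi>"
    using ex_minimal_sublinear[OF I(2)] by blast
  have lin: "linear \<phi>" by (rule minimal_sublinear_linear[OF \<phi>(1) min])
  have le: "\<phi> u \<le> H u" for u
    using cInf_lower[OF mem[OF D0 zero_less_one] I(1)] \<phi>(2)[of u] by (simp add: order_trans)
  \<comment> \<open>The quotient for \<open>- w\<close> and \<open>t = 1\<close> is
    \<open>H 0 = 0\<close>. Using this for both \<open>w\<close> and \<open>- w\<close> forces
    \<open>\<phi>\<close> to vanish on \<open>D\<close>.\<close>
  have "\<phi> w \<le> 0" if "w \<in> D" for w
    using cInf_lower[OF mem[of "- w" 1 w] I(1)] \<phi>(2)[of w] that D H0 by (simp add: subspace_neg)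
  then have "\<phi> w = 0" if "w \<in> D" for w
    using that D linear_neg[OF lin] by (metis neg_le_0_iff_le antisym subspace_neg)
  then show ?thesis using that lin le by blast
qed

section \<open>Subgradients of distance functions\<close>

text \<open>Convex combinations of nearly closest points stay in \<open>S\<close>. The slack
  \<open>e\<close> is there because the infimum may not be attained.\<close>

lemma convex_on_infdist:
  fixes S :: "'a::real_normed_vector set"
  assumes S: "convex S" "S \<noteq> {}"
  shows "convex_on UNIV (\<lambda>x. infdist x S)"
proof (intro convex_onI)
  fix t :: real and x y :: 'a
  assume t: "0 < t" "t < 1"
  show "infdist ((1 - t) *\<^sub>R x + t *\<^sub>R y) S \<le> (1 - t) * infdist x S + t * infdist y S"
  proof (rule field_le_epsilon)
    fix e :: real assume e: "0 < e"
    have near: "\<exists>a\<in>S. dist z a < infdist z S + e" for z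
      using cInf_lessD[of "dist z ` S" "infdist z S + e"] S(2) e by (auto simp: infdist_notempty)
    obtain a b where ab: "a \<in> S" "dist x a < infdist x S + e" "b \<in> S" "dist y b < infdist y S + e"
      using near by meson
    have "(1 - t) *\<^sub>R a + t *\<^sub>R b \<in> S" using S(1) ab t by (simp add: convexD)
    then have "infdist ((1 - t) *\<^sub>R x + t *\<^sub>R y) S \<le> dist ((1 - t) *\<^sub>R x + t *\<^sub>R y) ((1 - t) *\<^sub>R a + t *\<^sub>R b)"
      by (rule infdist_le)
    also have "\<dots> = norm ((1 - t) *\<^sub>R (x - a) + t *\<^sub>R (y - b))"
      by (simp add: dist_norm algebra_simps)
    also have "\<dots> \<le> (1 - t) * dist x a + t * dist y b"
      using norm_triangle_ineq[of "(1 - t) *\<^sub>R (x - a)" "t *\<^sub>R (y - b)"] t by (simp add: dist_norm)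
    also have "\<dots> \<le> (1 - t) * (infdist x S + e) + t * (infdist y S + e)"
      using ab t by (intro add_mono mult_left_mono) auto
    finally show "infdist ((1 - t) *\<^sub>R x + t *\<^sub>R y) S \<le> (1 - t) * infdist x S + t * infdist y S + e"
      by (simp add: algebra_simps)
  qed
qed simp

lemma infdist_diff_le_norm:
  fixes x :: "'a::real_normed_vector"
  shows "infdist (x + v) S - infdist x S \<le> norm v"
  using infdist_triangle[of "x + v" S x] by (simp add: dist_norm)

text \<open>The increment vanishes at 0, as \<open>convex_on_linear_minorant\<close> demands, and
  its linear minorants are the subgradients of the distance at \<open>x\<close>.\<close>

lemma convex_on_infdist_increment:
  fixes S :: "'a::real_normed_vector set"
  assumes "convex S" "S \<noteq> {}"
  shows "convex_on UNIV (\<lambda>v. infdist (x + v) S - infdist x S)"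
proof (intro convex_onI)
  fix t :: real and u v :: 'a
  assume t: "0 < t" "t < 1"
  have "x + ((1 - t) *\<^sub>R u + t *\<^sub>R v) = (1 - t) *\<^sub>R (x + u) + t *\<^sub>R (x + v)"
    by (simp add: algebra_simps)
  then have "infdist (x + ((1 - t) *\<^sub>R u + t *\<^sub>R v)) S
      \<le> (1 - t) * infdist (x + u) S + t * infdist (x + v) S"
    using convex_onD[OF convex_on_infdist[OF assms], of t "x + u" "x + v"] t by simp
  then show "infdist (x + ((1 - t) *\<^sub>R u + t *\<^sub>R v)) S - infdist x S
      \<le> (1 - t) * (infdist (x + u) S - infdist x S) + t * (infdist (x + v) S - infdist x S)"
    by (simp add: algebra_simps)
qed simp

text \<open>A one-sided bound suffices: applied at \<open>- v\<close>, it bounds the absolute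
  value.\<close>

lemma bounded_linear_if_le_norm:
  fixes \<phi> :: "'a::real_normed_vector \<Rightarrow> real"
  assumes "linear \<phi>" "\<And>v. \<phi> v \<le> K * norm v"
  shows "bounded_linear \<phi>"
proof (rule bounded_linear_intro[where K = K])
  show "norm (\<phi> v) \<le> norm v * K" for v
    using assms(2)[of v] assms(2)[of "- v"] linear_neg[OF assms(1), of v]
    by (simp add: abs_le_iff mult.commute)
qed (use assms(1) in \<open>auto simp: linear_add linear_cmul\<close>)

text \<open>The minorant for the trivial subspace is bounded because the distance is 1-Lipschitz. In
  the sum rule this supplies subgradients at indices of weight zero.\<close>

lemma subdifferential_infdist_nonempty:
  fixes S :: "'a::real_normed_vector set"
  assumes "convex S" "S \<noteq> {}"
  shows "subdifferential (\<lambda>x. infdist x S) x \<noteq> {}"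
proof -
  obtain \<phi> where \<phi>: "linear \<phi>" "\<And>v. \<phi> v \<le> infdist (x + v) S - infdist x S"
    using convex_on_linear_minorant[OF convex_on_infdist_increment[OF assms, of x], of "{0}"]
    by auto
  have "\<phi> v \<le> 1 * norm v" for v
    using \<phi>(2)[of v] infdist_diff_le_norm[of x v S] by simp
  then have "bounded_linear \<phi>" by (rule bounded_linear_if_le_norm[OF \<phi>(1)])
  then have "Blinfun \<phi> \<in> subdifferential (\<lambda>x. infdist x S) x"
    using \<phi>(2)[of "_ - x"] by (auto simp: subdifferential_def bounded_linear_Blinfun_apply)
  then show ?thesis by blast
qed

text \<open>The Hahn-Banach extension is applied on the product space, to the zero functional on the
  diagonal; the extension splits into one functional for each coordinate.\<close>

lemma weighted_infdist_sum_rule: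
  fixes \<Omega> :: "'n::finite \<Rightarrow> 'a::real_normed_vector set"
  assumes convex: "\<And>i. convex (\<Omega> i)" and ne: "\<And>i. \<Omega> i \<noteq> {}"
    and l: "\<And>i. 0 \<le> l i"
    and min: "\<And>y. (\<Sum>i\<in>UNIV. l i * infdist x (\<Omega> i)) \<le> (\<Sum>i\<in>UNIV. l i * infdist y (\<Omega> i))"
  obtains xs where "\<And>i. xs i \<in> subdifferential (\<lambda>x. infdist x (\<Omega> i)) x"
    and "(\<Sum>i\<in>UNIV. l i *\<^sub>R xs i) = 0"
proof -
  \<comment> \<open>Each coordinate of \<open>u\<close> displaces \<open>x\<close> for one distance
    only; the diagonal \<open>D\<close> consists of the common displacements.\<close>
  define h where "h i v = infdist (x + v) (\<Omega> i) - infdist x (\<Omega> i)" for i v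
  define H where "H u = (\<Sum>i\<in>UNIV. l i * h i (u $ i))" for u :: "'a ^ 'n"
  define D :: "('a ^ 'n) set" where "D = range (\<lambda>v. \<chi> i. v)"
  have h0: "h i 0 = 0" for i by (simp add: h_def)
  have "convex_on UNIV H"
  proof (intro convex_onI)
    fix t :: real and u v :: "'a ^ 'n"
    assume t: "0 < t" "t < 1"
    have "h i ((1 - t) *\<^sub>R u $ i + t *\<^sub>R v $ i) \<le> (1 - t) * h i (u $ i) + t * h i (v $ i)" for i
      using convex_onD[OF convex_on_infdist_increment[OF convex ne, of x]] t by (simp add: h_def)
    then have "l i * h i ((1 - t) *\<^sub>R u $ i + t *\<^sub>R v $ i)
        \<le> (1 - t) * (l i * h i (u $ i)) + t * (l i * h i (v $ i))" for i
      using mult_left_mono[OF _ l, of _ _ i] by (fastforce simp: algebra_simps)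
    then have "(\<Sum>i\<in>UNIV. l i * h i ((1 - t) *\<^sub>R u $ i + t *\<^sub>R v $ i))
        \<le> (\<Sum>i\<in>UNIV. (1 - t) * (l i * h i (u $ i)) + t * (l i * h i (v $ i)))"
      by (rule sum_mono)
    then show "H ((1 - t) *\<^sub>R u + t *\<^sub>R v) \<le> (1 - t) * H u + t * H v"
      by (simp add: H_def sum.distrib sum_distrib_left)
  qed simp
  moreover have "H 0 = 0" by (simp add: H_def h0)
  moreover have "subspace D"
    unfolding D_def by (rule linear_subspace_image) (auto intro!: linearI simp: vec_eq_iff)
  \<comment> \<open>On the diagonal, nonnegativity of \<open>H\<close> is the minimality of the
    weighted sum at \<open>x\<close>.\<close>
  moreover have "0 \<le> H w" if "w \<in> D" for w
    using that min by (auto simp: D_def H_def h_def right_diff_distrib sum_subtractf)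
  ultimately obtain \<Phi> where \<Phi>: "linear \<Phi>" "\<And>u. \<Phi> u \<le> H u" "\<And>w. w \<in> D \<Longrightarrow> \<Phi> w = 0"
    using convex_on_linear_minorant[of H D] by blast
  define \<phi> where "\<phi> i v = \<Phi> (axis i v)" for i v
  have axis_linear: "linear (axis i :: 'a \<Rightarrow> 'a ^ 'n)" for i
    by (auto intro!: linearI simp: axis_def vec_eq_iff)
  have lin: "linear (\<phi> i)" for i
    using linear_compose[OF axis_linear \<Phi>(1)] by (simp add: \<phi>_def[abs_def] comp_def)
  have le: "\<phi> i v \<le> l i * h i v" for i v
  proof -
    have "H (axis i v) = (\<Sum>j\<in>UNIV. if j = i then l i * h i v else 0)"
      unfolding H_def by (rule sum.cong) (auto simp: axis_def h0)
    then show ?thesis using \<Phi>(2)[of "axis i v"] by (simp add: \<phi>_def)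
  qed
  have bl: "bounded_linear (\<phi> i)" for i
  proof (rule bounded_linear_if_le_norm[OF lin, where K = "l i"])
    show "\<phi> i v \<le> l i * norm v" for v
      using le[of i v] mult_left_mono[OF infdist_diff_le_norm[of x v "\<Omega> i"] l[of i]]
      by (simp add: h_def)
  qed
  have sum0: "(\<Sum>i\<in>UNIV. \<phi> i v) = 0" for v
  proof -
    \<comment> \<open>A diagonal vector is the sum of its coordinate parts, so vanishing of
      \<open>\<Phi>\<close> on \<open>D\<close> makes the \<open>\<phi> i\<close> sum to
      zero.\<close>
    have "(\<Sum>i\<in>UNIV. axis i v) = ((\<chi> i. v) :: 'a ^ 'n)"
      by (simp add: vec_eq_iff axis_def)
    then have "(\<Sum>i\<in>UNIV. \<phi> i v) = \<Phi> (\<chi> i. v)"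
      unfolding \<phi>_def using linear_sum[OF \<Phi>(1), of "\<lambda>i. axis i v" UNIV] by simp
    also have "\<dots> = 0" by (rule \<Phi>(3)) (auto simp: D_def)
    finally show ?thesis .
  qed
  \<comment> \<open>Division by the weight fails when \<open>l i = 0\<close>; there any subgradient
    will do, since its term drops out and \<open>\<phi> i\<close> is zero as well.\<close>
  define xs where "xs i = (if l i = 0 then SOME \<xi>. \<xi> \<in> subdifferential (\<lambda>x. infdist x (\<Omega> i)) x
    else Blinfun (\<lambda>v. inverse (l i) * \<phi> i v))" for i
  have app: "blinfun_apply (xs i) v = inverse (l i) * \<phi> i v" if "l i \<noteq> 0" for i v
    using that bounded_linear_const_mult[OF bl] by (simp add: xs_def bounded_linear_Blinfun_apply)
  have "xs i \<in> subdifferential (\<lambda>x. infdist x (\<Omega> i)) x" for i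
  proof (cases "l i = 0")
    case True
    then show ?thesis
      using subdifferential_infdist_nonempty[OF convex ne, of i x] by (simp add: xs_def some_in_eq)
  next
    case False
    then have "0 < l i" using l[of i] by simp
    then have "inverse (l i) * \<phi> i v \<le> h i v" for v
      using le[of i v] by (simp add: field_simps)
    from this[of "_ - x"] show ?thesis
      using False by (auto simp: subdifferential_def app h_def)
  qed
  moreover have "l i * blinfun_apply (xs i) v = \<phi> i v" for i v
  proof (cases "l i = 0")
    case True
    then show ?thesis
      using le[of i v] le[of i "- v"] linear_neg[OF lin[of i], of v] by simp
  qed (simp add: app)
  then have "(\<Sum>i\<in>UNIV. l i *\<^sub>R xs i) = 0"
    by (intro blinfun_eqI) (simp add: blinfun.sum_left blinfun.scaleR_left sum0)
  ultimately show ?thesis using that by blast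
qed

section \<open>Multipliers for a monotone norm\<close>

text \<open>The inequality follows by scaling \<open>u\<close> to the unit sphere, once the supremum
  defining the dual norm is known to be finite. Monotonicity gives this by bounding each coordinate
  on the unit ball.\<close>

lemma is_norm_le_dual_norm:
  fixes N :: "real ^ 'n::finite \<Rightarrow> real"
  assumes N: "is_norm N"
    and mono: "\<And>\<alpha> \<beta>. (\<forall>i. \<bar>\<alpha> $ i\<bar> \<le> \<bar>\<beta> $ i\<bar>) \<Longrightarrow> N \<alpha> \<le> N \<beta>"
  shows "(\<Sum>i\<in>UNIV. l $ i * u $ i) \<le> dual_norm N l * N u"
proof -
  have scale: "N (c *\<^sub>R u) = \<bar>c\<bar> * N u" and nn: "0 \<le> N u" and z: "N u = 0 \<longleftrightarrow> u = 0" for c u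
    using N by (auto simp: is_norm_def)
  define k where "k i = N (axis i 1)" for i
  have k: "0 < k i" for i
  proof -
    have "N (axis i 1) \<noteq> 0" using z by simp
    then show ?thesis using nn[of "axis i 1"] unfolding k_def by linarith
  qed
  have comp: "\<bar>u $ i\<bar> * k i \<le> N u" for u i
  proof -
    have "\<bar>u $ i\<bar> * k i = N (u $ i *\<^sub>R axis i 1)" by (simp add: k_def scale)
    also have "\<dots> \<le> N u" by (rule mono) (simp add: axis_def)
    finally show ?thesis .
  qed
  let ?S = "{(\<Sum>i\<in>UNIV. l $ i * u $ i) | u. N u \<le> 1}"
  have "bdd_above ?S"
  proof (rule bdd_aboveI)
    fix s assume "s \<in> ?S"
    then obtain u where u: "N u \<le> 1" "s = (\<Sum>i\<in>UNIV. l $ i * u $ i)" by auto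
    have "l $ i * u $ i \<le> \<bar>l $ i\<bar> * (1 / k i)" for i
    proof -
      have "\<bar>u $ i\<bar> \<le> 1 / k i" using comp[of u i] u(1) k[of i] by (simp add: field_simps)
      then have "\<bar>l $ i\<bar> * \<bar>u $ i\<bar> \<le> \<bar>l $ i\<bar> * (1 / k i)" by (rule mult_left_mono) simp
      then show ?thesis by (simp add: abs_mult[symmetric])
    qed
    then show "s \<le> (\<Sum>i\<in>UNIV. \<bar>l $ i\<bar> * (1 / k i))" unfolding u(2) by (rule sum_mono)
  qed
  then have unit: "(\<Sum>i\<in>UNIV. l $ i * u $ i) \<le> dual_norm N l" if "N u \<le> 1" for u
    unfolding dual_norm_def using that by (intro cSup_upper) auto
  show ?thesis
  proof (cases "u = 0")
    case True
    then show ?thesis using z[of 0] by simp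
  next
    case False
    then have pos: "0 < N u" using nn[of u] z[of u] by simp
    have "(\<Sum>i\<in>UNIV. l $ i * (inverse (N u) *\<^sub>R u) $ i) \<le> dual_norm N l"
      using pos by (intro unit) (simp add: scale)
    also have "(\<Sum>i\<in>UNIV. l $ i * (inverse (N u) *\<^sub>R u) $ i) = inverse (N u) * (\<Sum>i\<in>UNIV. l $ i * u $ i)"
      by (simp add: sum_distrib_left mult.left_commute)
    finally show ?thesis using pos by (simp add: field_simps)
  qed
qed

text \<open>The multiplier is the normal of a hyperplane that separates the open \<open>N\<close>-ball of radius
  \<open>N (dist_vec \<Omega> x)\<close> from the set of all vectors dominating some \<open>dist_vec \<Omega> y\<close>.\<close>

lemma ex_multiplier:
  fixes \<Omega> :: "'n::finite \<Rightarrow> 'a::real_normed_vector set" and N :: "real ^ 'n \<Rightarrow> real"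
  assumes convex: "\<And>i. convex (\<Omega> i)" and ne: "\<And>i. \<Omega> i \<noteq> {}"
    and N: "is_norm N"
    and mono: "\<And>\<alpha> \<beta>. (\<forall>i. \<bar>\<alpha> $ i\<bar> \<le> \<bar>\<beta> $ i\<bar>) \<Longrightarrow> N \<alpha> \<le> N \<beta>"
    and x: "x \<in> Sol N \<Omega>" and pos: "0 < N (dist_vec \<Omega> x)"
  obtains l where "\<And>i. 0 \<le> l $ i" "dual_norm N l = 1"
    and "(\<Sum>i\<in>UNIV. l $ i * infdist x (\<Omega> i)) = N (dist_vec \<Omega> x)"
    and "\<And>y. N (dist_vec \<Omega> x) \<le> (\<Sum>i\<in>UNIV. l $ i * infdist y (\<Omega> i))"
proof -
  have scale: "N (c *\<^sub>R u) = \<bar>c\<bar> * N u" and nn: "0 \<le> N u" and z: "N u = 0 \<longleftrightarrow> u = 0"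
    and tri: "N (u + v) \<le> N u + N v" for c u v
    using N by (auto simp: is_norm_def)
  define m where "m = N (dist_vec \<Omega> x)"
  have m: "0 < m" using pos by (simp add: m_def)
  have dv: "dist_vec \<Omega> y $ i = infdist y (\<Omega> i)" for y i by (simp add: dist_vec_def)
  have dot: "a \<bullet> b = (\<Sum>i\<in>UNIV. a $ i * b $ i)" for a b :: "real ^ 'n"
    by (simp add: inner_vec_def)
  let ?S = "{r. N r < m}"
  \<comment> \<open>The distance vectors alone need not form a convex set; their upward closure
    does, by convexity of each distance.\<close>
  let ?T = "{r :: real ^ 'n. \<exists>y. \<forall>i. infdist y (\<Omega> i) \<le> r $ i}"
  have "convex ?S"
  proof (rule convexI)
    fix p q :: "real ^ 'n" and u v :: real
    assume pq: "p \<in> ?S" "q \<in> ?S" and uv: "0 \<le> u" "0 \<le> v" "u + v = 1"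
    have "N (u *\<^sub>R p + v *\<^sub>R q) \<le> u * N p + v * N q"
      using tri[of "u *\<^sub>R p" "v *\<^sub>R q"] uv by (simp add: scale)
    also have "\<dots> < m" using pq uv by (intro convex_bound_lt) auto
    finally show "u *\<^sub>R p + v *\<^sub>R q \<in> ?S" by simp
  qed
  moreover have "convex ?T"
  proof (rule convexI)
    fix p q :: "real ^ 'n" and u v :: real
    assume pq: "p \<in> ?T" "q \<in> ?T" and uv: "0 \<le> u" "0 \<le> v" "u + v = 1"
    obtain y y' where y: "\<And>i. infdist y (\<Omega> i) \<le> p $ i" "\<And>i. infdist y' (\<Omega> i) \<le> q $ i"
      using pq by auto
    have "infdist (u *\<^sub>R y + v *\<^sub>R y') (\<Omega> i) \<le> u * infdist y (\<Omega> i) + v * infdist y' (\<Omega> i)" for i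
      using convex_on_infdist[OF convex ne] uv by (auto simp: convex_on_def)
    also have "\<dots> i \<le> u * p $ i + v * q $ i" for i
      using y uv by (intro add_mono mult_left_mono) auto
    finally show "u *\<^sub>R p + v *\<^sub>R q \<in> ?T" by auto
  qed
  moreover have "0 \<in> ?S" using m z[of 0] by simp
  then have "?S \<noteq> {}" by blast
  moreover have dT: "dist_vec \<Omega> y \<in> ?T" for y by (auto simp: dv)
  then have "?T \<noteq> {}" by blast
  moreover have "?S \<inter> ?T = {}"
  proof -
    have "m \<le> N r" if r: "r \<in> ?T" for r
    proof -
      obtain y where y: "\<And>i. infdist y (\<Omega> i) \<le> r $ i" using r by auto
      have "m \<le> N (dist_vec \<Omega> y)" using x by (simp add: m_def Sol_def global_minimisers_def)
      also have "\<dots> \<le> N r"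
        \<comment> \<open>Distances are nonnegative, so \<open>r\<close> dominates the distance
          vector in absolute value too and monotonicity of \<open>N\<close> applies.\<close>
        using y by (intro mono) (simp add: dv infdist_nonneg order_trans[OF _ abs_ge_self])
      finally show ?thesis .
    qed
    then show ?thesis by force
  qed
  ultimately obtain a b where a: "a \<noteq> 0" and aS: "\<And>r. N r < m \<Longrightarrow> a \<bullet> r \<le> b"
    and aT: "\<And>r. r \<in> ?T \<Longrightarrow> b \<le> a \<bullet> r"
    using separating_hyperplane_sets[of ?S ?T] by auto
  have b: "0 < b"
  proof -
    have Na: "0 < N a" using nn[of a] z[of a] a by simp
    \<comment> \<open>This multiple of \<open>a\<close> has norm \<open>m / 2\<close>, hence lies in
      the ball, and its product with \<open>a\<close> is positive.\<close>
    have "N ((m / (2 * N a)) *\<^sub>R a) < m" using Na m by (simp add: scale)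
    then have "(m / (2 * N a)) * (a \<bullet> a) \<le> b" using aS by fastforce
    moreover have "0 < (m / (2 * N a)) * (a \<bullet> a)" using a m Na by simp
    ultimately show ?thesis by simp
  qed
  \<comment> \<open>The rescaling moves the separating level from \<open>b\<close> to
    \<open>m\<close>.\<close>
  define l where "l = (m / b) *\<^sub>R a"
  have lT: "m \<le> l \<bullet> r" if "r \<in> ?T" for r
    using aT[OF that] b m by (simp add: l_def field_simps)
  have lS: "l \<bullet> r \<le> m" if "N r < m" for r
    using aS[OF that] b m by (simp add: l_def field_simps)
  \<comment> \<open>Vectors are scaled into the open ball using any \<open>c\<close> above
    \<open>N r\<close>; letting \<open>c\<close> decrease to \<open>N r\<close> gives the
    bound.\<close>
  have lN: "l \<bullet> r \<le> N r" for r
  proof (rule dense_ge)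
    fix c assume c: "N r < c"
    then have c0: "0 < c" using nn[of r] by simp
    have "N ((m / c) *\<^sub>R r) < m" using c c0 m by (simp add: scale field_simps)
    then have "(m / c) * (l \<bullet> r) \<le> m" using lS by fastforce
    then show "l \<bullet> r \<le> c" using c0 m by (simp add: field_simps)
  qed
  have eq: "l \<bullet> dist_vec \<Omega> x = m"
    using lN[of "dist_vec \<Omega> x"] lT[OF dT[of x]] by (simp add: m_def)
  have "0 \<le> l $ i" for i
  proof -
    \<comment> \<open>Raising one coordinate stays in \<open>?T\<close>, so the product with
      \<open>l\<close> cannot fall below its value \<open>m\<close> at
      \<open>dist_vec \<Omega> x\<close>.\<close>
    have "dist_vec \<Omega> x + axis i 1 \<in> ?T"
      by (auto simp: dv axis_def intro!: exI[of _ x])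
    from lT[OF this] have "m \<le> l \<bullet> dist_vec \<Omega> x + l \<bullet> axis i 1" by (simp only: inner_add_right)
    then show ?thesis using eq by (simp add: inner_axis)
  qed
  moreover have "dual_norm N l = 1"
    unfolding dual_norm_def
  proof (rule cSup_eq_maximum)
    \<comment> \<open>The supremum is attained at the normalised distance vector of
      \<open>x\<close>.\<close>
    have "N (inverse m *\<^sub>R dist_vec \<Omega> x) = 1" using m by (simp add: scale m_def)
    moreover have "l \<bullet> (inverse m *\<^sub>R dist_vec \<Omega> x) = 1" using eq m by simp
    ultimately show "1 \<in> {(\<Sum>i\<in>UNIV. l $ i * u $ i) | u. N u \<le> 1}"
      unfolding dot[symmetric] by (intro CollectI exI[of _ "inverse m *\<^sub>R dist_vec \<Omega> x"]) simp
    show "s \<le> 1" if "s \<in> {(\<Sum>i\<in>UNIV. l $ i * u $ i) | u. N u \<le> 1}" for s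
      using that lN unfolding dot[symmetric] by (auto intro: order_trans)
  qed
  moreover have "(\<Sum>i\<in>UNIV. l $ i * infdist x (\<Omega> i)) = N (dist_vec \<Omega> x)"
    using eq by (simp add: dot dv m_def)
  moreover have "N (dist_vec \<Omega> x) \<le> (\<Sum>i\<in>UNIV. l $ i * infdist y (\<Omega> i))" for y
    using lT[OF dT[of y]] by (simp add: dot dv m_def)
  ultimately show ?thesis using that by blast
qed

text \<open>The weighted linear terms cancel when the subgradient inequalities are summed.
  Subgradients are required only at positive weights, so that points of the solution set in the
  second assertion qualify as \<open>x\<close>.\<close>

lemma weighted_infdist_affine_minorant:
  fixes \<Omega> :: "'n::finite \<Rightarrow> 'a::real_normed_vector set" and l :: "real ^ 'n"
  assumes "\<And>i. 0 \<le> l $ i" "(\<Sum>i\<in>UNIV. (l $ i) *\<^sub>R xs i) = 0"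
    and "\<And>i. 0 < l $ i \<Longrightarrow> xs i \<in> subdifferential (\<lambda>u. infdist u (\<Omega> i)) x"
  shows "(\<Sum>i\<in>UNIV. l $ i * infdist x (\<Omega> i)) \<le> (\<Sum>i\<in>UNIV. l $ i * infdist y (\<Omega> i))"
proof -
  have "(\<Sum>i\<in>UNIV. l $ i * blinfun_apply (xs i) (y - x)) = 0"
    using arg_cong[OF assms(2), of "\<lambda>\<xi>. blinfun_apply \<xi> (y - x)"]
    by (simp add: blinfun.sum_left blinfun.scaleR_left)
  moreover have "l $ i * blinfun_apply (xs i) (y - x) \<le> l $ i * (infdist y (\<Omega> i) - infdist x (\<Omega> i))" for i
    using assms(1)[of i] assms(3)[of i]
    by (cases "l $ i = 0") (auto simp: subdifferential_def intro!: mult_left_mono)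
  then have "(\<Sum>i\<in>UNIV. l $ i * blinfun_apply (xs i) (y - x))
      \<le> (\<Sum>i\<in>UNIV. l $ i * (infdist y (\<Omega> i) - infdist x (\<Omega> i)))"
    by (rule sum_mono)
  ultimately show ?thesis by (simp add: right_diff_distrib sum_subtractf)
qed

text \<open>An affine minorant of \<open>g\<close> that is exact at \<open>y\<close> supports
  \<open>g\<close> there as well.\<close>

lemma subdifferential_transport:
  assumes "\<xi> \<in> subdifferential g x" "g y = g x + blinfun_apply \<xi> (y - x)"
  shows "\<xi> \<in> subdifferential g y"
  unfolding subdifferential_def
proof (intro CollectI allI)
  fix z
  have "blinfun_apply \<xi> (z - x) \<le> g z - g x" using assms(1) by (simp add: subdifferential_def)
  then show "blinfun_apply \<xi> (z - y) \<le> g z - g y" using assms(2) by (simp add: blinfun.diff_right)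
qed

section \<open>Optimality criterion and description of the solution set\<close>

theorem theorem3p6:
  fixes \<Omega> :: "'n::finite \<Rightarrow> 'a::real_normed_vector set"
    and N :: "real ^ 'n \<Rightarrow> real"
    and xbar :: 'a
  assumes nonempty: "\<And>i. \<Omega> i \<noteq> {}"
    and closed: "\<And>i. closed (\<Omega> i)"
    and convex: "\<And>i. convex (\<Omega> i)"
    and norm: "is_norm N"
    and A1: "\<And>\<alpha> s. (\<forall>i. s $ i = 1 \<or> s $ i = - 1) \<Longrightarrow> N (\<chi> i. s $ i * \<alpha> $ i) = N \<alpha>"
    and A2: "\<And>\<alpha> \<beta>. (\<forall>i. \<bar>\<alpha> $ i\<bar> \<le> \<bar>\<beta> $ i\<bar>) \<Longrightarrow> N \<alpha> \<le> N \<beta>"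
    and xbar: "xbar \<notin> (\<Union>i. \<Omega> i)"
  shows
    "(xbar \<in> Sol N \<Omega> \<longleftrightarrow>
       (\<exists>(l :: real ^ 'n) (xs :: 'n \<Rightarrow> ('a \<Rightarrow>\<^sub>L real)).
          (\<forall>i. 0 \<le> l $ i) \<and>
          (\<forall>i. xs i \<in> subdifferential (\<lambda>x. infdist x (\<Omega> i)) xbar) \<and>
          multiplier_condition N \<Omega> xbar l xs)) \<and>
     (\<forall>(l :: real ^ 'n) (xs :: 'n \<Rightarrow> ('a \<Rightarrow>\<^sub>L real)).
        (\<forall>i. 0 \<le> l $ i) \<and>
        (\<forall>i. xs i \<in> subdifferential (\<lambda>x. infdist x (\<Omega> i)) xbar) \<and>
        multiplier_condition N \<Omega> xbar l xs \<longrightarrow>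
        Sol N \<Omega> =
          {x. (\<forall>i. l $ i > 0 \<longrightarrow> xs i \<in> subdifferential (\<lambda>u. infdist u (\<Omega> i)) x) \<and>
              (\<Sum>i\<in>{i. l $ i > 0}. l $ i * infdist x (\<Omega> i)) = N (dist_vec \<Omega> x)})"
proof -
  let ?d = "\<lambda>x. dist_vec \<Omega> x"
  let ?L = "\<lambda>(l :: real ^ 'n) x. \<Sum>i\<in>UNIV. l $ i * infdist x (\<Omega> i)"
  let ?M = "\<lambda>(l :: real ^ 'n) (xs :: 'n \<Rightarrow> ('a \<Rightarrow>\<^sub>L real)). (\<forall>i. 0 \<le> l $ i) \<and>
    (\<forall>i. xs i \<in> subdifferential (\<lambda>x. infdist x (\<Omega> i)) xbar) \<and> multiplier_condition N \<Omega> xbar l xs"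
  have Sol_iff: "x \<in> Sol N \<Omega> \<longleftrightarrow> (\<forall>y. N (?d x) \<le> N (?d y))" for x
    by (simp add: Sol_def global_minimisers_def)
  \<comment> \<open>Closedness makes every distance from \<open>xbar\<close> positive.\<close>
  have pos: "0 < N (?d xbar)"
  proof -
    have "0 < infdist xbar (\<Omega> i)" for i
      using infdist_pos_not_in_closed[OF closed nonempty] xbar by blast
    then have "?d xbar \<noteq> 0" by (auto simp: vec_eq_iff dist_vec_def less_le)
    then show ?thesis using norm by (auto simp: is_norm_def less_le)
  qed
  have L_le: "?L l x \<le> N (?d x)" if "dual_norm N l = 1" for l x
    using is_norm_le_dual_norm[OF norm A2, of l "?d x"] that by (simp add: dist_vec_def)
  have suff: "xbar \<in> Sol N \<Omega>" if M: "?M l xs" for l xs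
    unfolding Sol_iff
  proof
    fix y
    have "N (?d xbar) = ?L l xbar" using M by (simp add: multiplier_condition_def)
    also have "\<dots> \<le> ?L l y"
      using M by (intro weighted_infdist_affine_minorant) (auto simp: multiplier_condition_def)
    also have "\<dots> \<le> N (?d y)" using M by (intro L_le) (simp add: multiplier_condition_def)
    finally show "N (?d xbar) \<le> N (?d y)" .
  qed
  have nec: "\<exists>l xs. ?M l xs" if sol: "xbar \<in> Sol N \<Omega>"
  proof -
    obtain l where l: "\<And>i. 0 \<le> l $ i" "dual_norm N l = 1" "?L l xbar = N (?d xbar)"
      "\<And>y. N (?d xbar) \<le> ?L l y"
      using ex_multiplier[OF convex nonempty norm A2 sol pos] by blast
    \<comment> \<open>The weights make \<open>xbar\<close> a minimiser of \<open>?L l\<close>, since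
      \<open>?L l xbar\<close> equals the lower bound \<open>N (?d xbar)\<close>.\<close>
    obtain xs where "\<And>i. xs i \<in> subdifferential (\<lambda>x. infdist x (\<Omega> i)) xbar"
      "(\<Sum>i\<in>UNIV. l $ i *\<^sub>R xs i) = 0"
      using weighted_infdist_sum_rule[of \<Omega> "\<lambda>i. l $ i" xbar] convex nonempty l by metis
    then show ?thesis using l by (auto simp: multiplier_condition_def)
  qed
  have sol: "Sol N \<Omega> = {x. (\<forall>i. l $ i > 0 \<longrightarrow> xs i \<in> subdifferential (\<lambda>u. infdist u (\<Omega> i)) x) \<and>
      (\<Sum>i\<in>{i. l $ i > 0}. l $ i * infdist x (\<Omega> i)) = N (?d x)}" (is "_ = ?R")
    if M: "?M l xs" for l xs
  proof -
    have l: "\<And>i. 0 \<le> l $ i" "dual_norm N l = 1" "?L l xbar = N (?d xbar)"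
      and xs0: "(\<Sum>i\<in>UNIV. l $ i *\<^sub>R xs i) = 0"
      and xs: "\<And>i. xs i \<in> subdifferential (\<lambda>x. infdist x (\<Omega> i)) xbar"
      using M by (auto simp: multiplier_condition_def)
    have sum_pos: "(\<Sum>i\<in>{i. l $ i > 0}. l $ i * infdist x (\<Omega> i)) = ?L l x" for x
      by (rule sum.mono_neutral_left) (use l(1) in \<open>auto simp: less_le\<close>)
    show ?thesis
    proof (intro set_eqI iffI)
      fix x assume "x \<in> ?R"
      then have "N (?d x) = ?L l x"
        and sub: "\<And>i. 0 < l $ i \<Longrightarrow> xs i \<in> subdifferential (\<lambda>u. infdist u (\<Omega> i)) x"
        by (auto simp: sum_pos)
      moreover have "?L l x \<le> ?L l xbar"
        by (rule weighted_infdist_affine_minorant[OF l(1) xs0 sub])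
      ultimately have "N (?d x) \<le> N (?d xbar)" using l(3) by simp
      then show "x \<in> Sol N \<Omega>" using suff[OF M] by (auto simp: Sol_iff intro: order_trans)
    next
      fix x assume "x \<in> Sol N \<Omega>"
      \<comment> \<open>The chain
        \<open>N (?d x) \<le> ?L l xbar \<le> ?L l x \<le> N (?d x)\<close> collapses to
        equalities.\<close>
      then have "N (?d x) \<le> ?L l xbar" using l(3) by (simp add: Sol_iff)
      moreover have "?L l xbar \<le> ?L l x"
        by (rule weighted_infdist_affine_minorant[OF l(1) xs0 xs])
      ultimately have eq: "?L l x = N (?d x)" "?L l x = ?L l xbar"
        using L_le[OF l(2), of x] by auto
      \<comment> \<open>This is the slack in the subgradient inequality. The slacks are nonnegative
        and their weighted sum is zero, so each one of positive weight vanishes.\<close>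
      define gap where "gap i = infdist x (\<Omega> i) - infdist xbar (\<Omega> i) - blinfun_apply (xs i) (x - xbar)" for i
      have gap: "0 \<le> gap i" for i
        using xs[of i] by (auto simp: gap_def subdifferential_def)
      have "(\<Sum>i\<in>UNIV. l $ i * blinfun_apply (xs i) (x - xbar)) = 0"
        using arg_cong[OF xs0, of "\<lambda>\<xi>. blinfun_apply \<xi> (x - xbar)"]
        by (simp add: blinfun.sum_left blinfun.scaleR_left)
      then have "(\<Sum>i\<in>UNIV. l $ i * gap i) = 0"
        using eq(2) by (simp add: gap_def right_diff_distrib sum_subtractf)
      then have "l $ i * gap i = 0" for i
        using gap l(1) by (simp add: sum_nonneg_eq_0_iff)
      then have "infdist x (\<Omega> i) = infdist xbar (\<Omega> i) + blinfun_apply (xs i) (x - xbar)"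
        if "0 < l $ i" for i
        using that \<open>l $ i * gap i = 0\<close> by (simp add: gap_def)
      then have "xs i \<in> subdifferential (\<lambda>u. infdist u (\<Omega> i)) x" if "0 < l $ i" for i
        using that by (intro subdifferential_transport[OF xs]) auto
      then show "x \<in> ?R" using eq(1) by (simp add: sum_pos)
    qed
  qed
  show ?thesis using suff nec sol by blast
qed

end
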